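(* Let $f,\psi$ be differentiable on $[a,b]$. Then, as Sequential Henstock integrals, $$\int_{\psi(a)}^{\psi(b)}f'=\int_a^b(f'\circ\psi)\,\psi'.$$
   Context: Here $[a,b]\subset\mathbb{R}$ is a compact interval, $f$ and $\psi$ are real-valued functions, and $f'\circ\psi$ denotes the composition $x\mapsto f'(\psi(x))$. Orientation convention: $\int_q^p g=-\int_p^q g$ for $p<q$ and $\int_p^p g=0$. For a compact interval $I=[p,q]\subset\mathbb{R}$ with $p<q$: a tagged partition $P=\{([x_{i-1},x_i],t_i)\}_{i=1}^k$ of $I$ consists of points $p=x_0<x_1<\dots<x_k=q$ together with tags $t_i\in[x_{i-1},x_i]$. Its Riemann sum for $g$ is $S(g,P)=\sum_{i=1}^k g(t_i)(x_i-x_{i-1})$. A gauge on $I$ is a function $\delta:I\to\mathbb{R}$ with $\delta(x)>0$ for all $x\in I$. $P$ is $\delta(x)$-fine if $x_i-x_{i-1}<\delta(t_i)$ for every $i$. A function $g:I\to\mathbb{R}$ is Sequential Henstock integrable on $I$ with integral $A=\int_I g=\int_p^q g\in\mathbb{R}$ if there is a sequence of gauges $\{\delta_n\}_{n=1}^\infty$ on $I$ such that, whenever $P_n$ is a $\delta_n(x)$-fine tagged partition of $I$ for each $n$, one has $S(g,P_n)\to A$ as $n\to\infty$.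
   Formalization: As stated, f'∘ψ and the left integral may be undefined when ψ leaves [a,b]; it is assumed that ψ([a,b]) lies in a compact interval [c,d], c<d, on which f is differentiable (one-sidedly at endpoints); [c,d]=[a,b] is the literal case. *)

theory Defs
  imports "HOL-Analysis.Analysis"
begin

(* (k, x, t): division points x 0 < ... < x k and tags t 0, ..., t (k - 1), where t i is the
   tag of [x i, x (i + 1)].  Values of x and t at other indices are irrelevant. *)
type_synonym tagged_partition = "nat \<times> (nat \<Rightarrow> real) \<times> (nat \<Rightarrow> real)"

definition is_tagged_partition :: "real \<Rightarrow> real \<Rightarrow> tagged_partition \<Rightarrow> bool" where
  "is_tagged_partition p q P \<longleftrightarrow>
     (case P of (k, x, t) \<Rightarrow>
        x 0 = p \<and> x k = q \<and> (\<forall>i<k. x i < x (Suc i) \<and> t i \<in> {x i..x (Suc i)}))"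

definition riemann_sum :: "(real \<Rightarrow> real) \<Rightarrow> tagged_partition \<Rightarrow> real" where
  "riemann_sum g P = (case P of (k, x, t) \<Rightarrow> \<Sum>i<k. g (t i) * (x (Suc i) - x i))"

(* Not the library's gauge, which assigns an open set to each point. *)
definition real_gauge_on :: "real \<Rightarrow> real \<Rightarrow> (real \<Rightarrow> real) \<Rightarrow> bool" where
  "real_gauge_on p q \<delta> \<longleftrightarrow> (\<forall>x\<in>{p..q}. \<delta> x > 0)"

definition is_fine :: "(real \<Rightarrow> real) \<Rightarrow> tagged_partition \<Rightarrow> bool" where
  "is_fine \<delta> P \<longleftrightarrow> (case P of (k, x, t) \<Rightarrow> \<forall>i<k. x (Suc i) - x i < \<delta> (t i))"

(* Meant for p < q; the oriented notions below use it only in that case. *)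
definition has_seq_henstock_integral ::
  "(real \<Rightarrow> real) \<Rightarrow> real \<Rightarrow> real \<Rightarrow> real \<Rightarrow> bool" where
  "has_seq_henstock_integral g p q A \<longleftrightarrow>
     (\<exists>\<delta> :: nat \<Rightarrow> real \<Rightarrow> real.
        (\<forall>n. real_gauge_on p q (\<delta> n)) \<and>
        (\<forall>P :: nat \<Rightarrow> tagged_partition.
           (\<forall>n. is_tagged_partition p q (P n) \<and> is_fine (\<delta> n) (P n)) \<longrightarrow>
           (\<lambda>n. riemann_sum g (P n)) \<longlonglongrightarrow> A))"

(* The endpoints may come in either order; the degenerate case p = q is always integrable. *)
definition seq_henstock_integrable :: "(real \<Rightarrow> real) \<Rightarrow> real \<Rightarrow> real \<Rightarrow> bool" where
  "seq_henstock_integrable g p q \<longleftrightarrow>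
     p = q \<or> (\<exists>A. has_seq_henstock_integral g (min p q) (max p q) A)"

definition seq_henstock_integral :: "(real \<Rightarrow> real) \<Rightarrow> real \<Rightarrow> real \<Rightarrow> real" where
  "seq_henstock_integral g p q =
     (if p < q then (THE A. has_seq_henstock_integral g p q A)
      else if q < p then - (THE A. has_seq_henstock_integral g q p A)
      else 0)"

end

theory Submission
  imports Defs
begin

text \<open>Both integrals are instances of the fundamental theorem of calculus, which the Henstock
  integral satisfies for every derivative, because its gauge may vary from point to point. If \<open>F\<close> is an antiderivative of \<open>g\<close> on \<open>[p, q]\<close>, let the \<open>n\<close>-th gauge
  at \<open>t\<close> be so small that the linear approximation of \<open>F\<close> at \<open>t\<close> is accurate up to
  \<open>1 / (n + 1)\<close> times the distance. The tag lies inside its cell \<open>[u, v]\<close>, so the errors at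
  the two ends add up to at most \<open>(v - u) / (n + 1)\<close> (\<open>straddle\<close>), and summing over the
  cells shows that Riemann sums differ from \<open>F q - F p\<close> by at most \<open>(q - p) / (n + 1)\<close>
  (\<open>has_seq_henstock_integral_derivative\<close>).

  The integral is a definite description, so its value is known only once limits of Riemann sums
  are unique. That rests on Cousin's lemma: every gauge admits a fine tagged partition, whence
  two admissible sequences of gauges have a common sequence of fine partitions.

  The substitution rule follows by applying the fundamental theorem to \<open>f\<close> between
  \<open>\<psi> a\<close> and \<open>\<psi> b\<close>, and to \<open>f \<circ> \<psi>\<close>, whose derivative is given by the chain rule,
  between \<open>a\<close> and \<open>b\<close>: both integrals equal \<open>f (\<psi> b) - f (\<psi> a)\<close>.\<close>

lemma tagged_partition_mono:
  assumes "is_tagged_partition p q (k, x, t)" and "i \<le> j" and "j \<le> k"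
  shows "x i \<le> x j"
  using assms(2,3)
proof (induction j rule: dec_induct)
  case base
  then show ?case by simp
next
  case (step j)
  then have "x j < x (Suc j)"
    using assms(1) by (simp add: is_tagged_partition_def)
  with step show ?case by simp
qed

lemma tagged_partition_append:
  assumes "is_tagged_partition p q P" "is_fine \<delta> P"
    and "is_tagged_partition q r Q" "is_fine \<delta> Q"
  shows "\<exists>R. is_tagged_partition p r R \<and> is_fine \<delta> R"
proof -
  obtain k x t where P: "P = (k, x, t)" by (cases P)
  obtain l y s where Q: "Q = (l, y, s)" by (cases Q)
  define z where "z i = (if i \<le> k then x i else y (i - k))" for i
  define w where "w i = (if i < k then t i else s (i - k))" for i
  have join: "x k = y 0"
    using assms P Q by (simp add: is_tagged_partition_def)
  \<comment> \<open>At the joint \<open>i = k\<close> both descriptions of \<open>z\<close> agree, so cell \<open>k + j\<close> is cell \<open>j\<close>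
    of the second partition, including \<open>j = 0\<close>.\<close>
  have right: "z i = y (i - k)" if "k \<le> i" for i
    using that join by (cases "i = k") (auto simp: z_def)
  have cell: "z i < z (Suc i) \<and> w i \<in> {z i..z (Suc i)} \<and> z (Suc i) - z i < \<delta> (w i)"
    if "i < k + l" for i
  proof (cases "i < k")
    case True
    then show ?thesis
      using assms(1,2) P by (simp add: z_def w_def is_tagged_partition_def is_fine_def)
  next
    case False
    then have "i - k < l" "Suc i - k = Suc (i - k)" using that by auto
    then show ?thesis
      using False assms(3,4) Q right[of i] right[of "Suc i"]
      by (simp add: w_def is_tagged_partition_def is_fine_def)
  qed
  have "z 0 = p" "z (k + l) = r"
    using assms P Q right[of "k + l"] by (simp_all add: z_def is_tagged_partition_def)
  with cell have "is_tagged_partition p r (k + l, z, w)" "is_fine \<delta> (k + l, z, w)"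
    by (simp_all add: is_tagged_partition_def is_fine_def)
  then show ?thesis by blast
qed

text \<open>Cousin's lemma. Fine partitions of adjacent intervals can be concatenated, and an interval
  around \<open>x\<close> of length less than \<open>\<delta> x\<close> is itself a fine cell with tag \<open>x\<close>; Bolzano's
  bisection principle turns these two facts into existence on the whole interval. A one-point
  interval, which the bisection principle also considers, has the partition without cells.\<close>

lemma fine_tagged_partition_exists:
  assumes "p \<le> q" and "real_gauge_on p q \<delta>"
  shows "\<exists>P. is_tagged_partition p q P \<and> is_fine \<delta> P"
  using assms(1)
proof (induction rule: Bolzano)
  case (trans u v w)
  then show ?case using tagged_partition_append by blast
next
  case (local x)
  have "\<exists>P. is_tagged_partition u v P \<and> is_fine \<delta> P"
    if "u \<le> x" "x \<le> v" "v - u < \<delta> x" for u v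
  proof (cases "u = v")
    case True
    then have "is_tagged_partition u v (0, \<lambda>_. u, \<lambda>_. u)" "is_fine \<delta> (0, \<lambda>_. u, \<lambda>_. u)"
      by (simp_all add: is_tagged_partition_def is_fine_def)
    then show ?thesis by blast
  next
    case False
    with that have "is_tagged_partition u v (1, \<lambda>i. if i = 0 then u else v, \<lambda>_. x)"
      "is_fine \<delta> (1, \<lambda>i. if i = 0 then u else v, \<lambda>_. x)"
      by (simp_all add: is_tagged_partition_def is_fine_def)
    then show ?thesis by blast
  qed
  moreover have "\<delta> x > 0" using assms(2) local by (simp add: real_gauge_on_def)
  ultimately show ?case by blast
qed

text \<open>The pointwise minimum of two gauges is a gauge, and its fine partitions are fine for both.\<close>

lemma has_seq_henstock_integral_unique:
  assumes "p \<le> q" and "has_seq_henstock_integral g p q A" and "has_seq_henstock_integral g p q B"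
  shows "A = B"
proof -
  obtain \<delta> where \<delta>: "\<And>n. real_gauge_on p q (\<delta> n)"
    and A: "\<And>P. (\<And>n. is_tagged_partition p q (P n) \<and> is_fine (\<delta> n) (P n)) \<Longrightarrow>
      (\<lambda>n. riemann_sum g (P n)) \<longlonglongrightarrow> A"
    using assms(2) unfolding has_seq_henstock_integral_def by blast
  obtain \<epsilon> where \<epsilon>: "\<And>n. real_gauge_on p q (\<epsilon> n)"
    and B: "\<And>P. (\<And>n. is_tagged_partition p q (P n) \<and> is_fine (\<epsilon> n) (P n)) \<Longrightarrow>
      (\<lambda>n. riemann_sum g (P n)) \<longlonglongrightarrow> B"
    using assms(3) unfolding has_seq_henstock_integral_def by blast
  define \<gamma> where "\<gamma> n x = min (\<delta> n x) (\<epsilon> n x)" for n x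
  have "real_gauge_on p q (\<gamma> n)" for n
    using \<delta>[of n] \<epsilon>[of n] by (simp add: real_gauge_on_def \<gamma>_def)
  then have "\<forall>n. \<exists>P. is_tagged_partition p q P \<and> is_fine (\<gamma> n) P"
    using fine_tagged_partition_exists[OF assms(1)] by blast
  then obtain P where P: "\<And>n. is_tagged_partition p q (P n)" "\<And>n. is_fine (\<gamma> n) (P n)"
    by metis
  have "is_fine (\<delta> n) (P n)" "is_fine (\<epsilon> n) (P n)" for n
    using P(2)[of n] by (auto simp: is_fine_def \<gamma>_def split: prod.splits)
  then show ?thesis
    using LIMSEQ_unique A[of P] B[of P] P(1) by blast
qed

lemma straddle:
  fixes F :: "real \<Rightarrow> real"
  assumes "\<And>y. y \<in> {u, v} \<Longrightarrow> \<bar>F y - F t - D * (y - t)\<bar> \<le> e * \<bar>y - t\<bar>"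
    and "u \<le> t" and "t \<le> v"
  shows "\<bar>D * (v - u) - (F v - F u)\<bar> \<le> e * (v - u)"
proof -
  have "\<bar>F v - F t - D * (v - t)\<bar> \<le> e * (v - t)" "\<bar>F u - F t - D * (u - t)\<bar> \<le> e * (t - u)"
    using assms(1)[of v] assms(1)[of u] assms(2,3) by simp_all
  then show ?thesis by (simp add: algebra_simps abs_le_iff)
qed

lemma riemann_sum_derivative_error:
  assumes P: "is_tagged_partition p q P" "is_fine \<delta> P"
    and approx: "\<And>t y. t \<in> {p..q} \<Longrightarrow> y \<in> {p..q} \<Longrightarrow> \<bar>y - t\<bar> < \<delta> t \<Longrightarrow>
      \<bar>F y - F t - g t * (y - t)\<bar> \<le> e * \<bar>y - t\<bar>"
  shows "\<bar>riemann_sum g P - (F q - F p)\<bar> \<le> e * (q - p)"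
proof -
  obtain k x t where [simp]: "P = (k, x, t)" by (cases P)
  have ends: "x 0 = p" "x k = q"
    using P(1) by (simp_all add: is_tagged_partition_def)
  have cell: "\<bar>g (t i) * (x (Suc i) - x i) - (F (x (Suc i)) - F (x i))\<bar> \<le> e * (x (Suc i) - x i)"
    if "i < k" for i
  proof -
    have t: "x i \<le> t i" "t i \<le> x (Suc i)" "x (Suc i) - x i < \<delta> (t i)"
      using P that by (simp_all add: is_tagged_partition_def is_fine_def)
    have "p \<le> x i" "x (Suc i) \<le> q"
      using tagged_partition_mono[of p q k x t 0 i] tagged_partition_mono[of p q k x t "Suc i" k]
        P(1) that ends by auto
    with t show ?thesis
      by (intro straddle[where t = "t i"] approx) auto
  qed
  have "riemann_sum g P - (F q - F p) =
      (\<Sum>i<k. g (t i) * (x (Suc i) - x i) - (F (x (Suc i)) - F (x i)))"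
    using sum_lessThan_telescope[of "\<lambda>i. F (x i)" k] ends
    by (simp add: riemann_sum_def sum_subtractf)
  also have "\<bar>\<dots>\<bar> \<le> (\<Sum>i<k. e * (x (Suc i) - x i))"
    by (rule order_trans[OF sum_abs sum_mono]) (simp add: cell)
  also have "\<dots> = e * (q - p)"
    using sum_lessThan_telescope[of x k] ends by (simp flip: sum_distrib_left)
  finally show ?thesis .
qed

text \<open>The fundamental theorem of calculus. Differentiability at a point is exactly what makes a
  positive gauge value there available for each accuracy \<open>1 / (n + 1)\<close>.\<close>

lemma has_seq_henstock_integral_derivative:
  assumes deriv: "\<And>x. x \<in> {p..q} \<Longrightarrow> (F has_real_derivative g x) (at x within {p..q})"
  shows "has_seq_henstock_integral g p q (F q - F p)"
proof -
  define accurate where "accurate n x d \<longleftrightarrow> (x \<in> {p..q} \<longrightarrow> (\<forall>y\<in>{p..q}. \<bar>y - x\<bar> < d \<longrightarrow>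
      \<bar>F y - F x - g x * (y - x)\<bar> \<le> inverse (real (Suc n)) * \<bar>y - x\<bar>))" for n x d
  have "\<exists>d>0. accurate n x d" for n x
  proof (cases "x \<in> {p..q}")
    case True
    have "inverse (real (Suc n)) > 0" by simp
    moreover have "\<forall>e>0. \<exists>d>0. \<forall>y\<in>{p..q}. \<bar>y - x\<bar> < d \<longrightarrow>
        \<bar>F y - F x - g x * (y - x)\<bar> \<le> e * \<bar>y - x\<bar>"
      using deriv[OF True]
      by (simp add: has_field_derivative_def has_derivative_within_alt)
    ultimately show ?thesis
      unfolding accurate_def by meson
  qed (auto simp: accurate_def intro: exI[of _ 1])
  then obtain \<delta> where pos: "\<And>n x. \<delta> n x > 0" and acc: "\<And>n x. accurate n x (\<delta> n x)"
    by metis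
  have approx: "\<bar>F y - F x - g x * (y - x)\<bar> \<le> inverse (real (Suc n)) * \<bar>y - x\<bar>"
    if "x \<in> {p..q}" "y \<in> {p..q}" "\<bar>y - x\<bar> < \<delta> n x" for n x y
    using acc[of n x] that unfolding accurate_def by blast
  have "(\<lambda>n. riemann_sum g (P n)) \<longlonglongrightarrow> F q - F p"
    if P: "\<forall>n. is_tagged_partition p q (P n) \<and> is_fine (\<delta> n) (P n)" for P
  proof -
    have "norm (riemann_sum g (P n) - (F q - F p)) \<le> inverse (real (Suc n)) * (q - p)" for n
      unfolding real_norm_def
    proof (rule riemann_sum_derivative_error)
      show "is_tagged_partition p q (P n)" "is_fine (\<delta> n) (P n)"
        using P by blast+
    qed (rule approx)
    moreover have "(\<lambda>n. inverse (real (Suc n)) * (q - p)) \<longlonglongrightarrow> 0"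
      using tendsto_mult_left_zero[OF LIMSEQ_inverse_real_of_nat] .
    ultimately have "(\<lambda>n. riemann_sum g (P n) - (F q - F p)) \<longlonglongrightarrow> 0"
      by (rule Lim_null_comparison[OF always_eventually[OF allI]])
    then show ?thesis by (simp add: LIM_zero_iff)
  qed
  then show ?thesis
    using pos unfolding has_seq_henstock_integral_def real_gauge_on_def by blast
qed

lemma seq_henstock_integral_derivative:
  assumes deriv: "\<And>x. x \<in> {min p q..max p q} \<Longrightarrow>
      (F has_real_derivative g x) (at x within {min p q..max p q})"
  shows "seq_henstock_integrable g p q \<and> seq_henstock_integral g p q = F q - F p"
proof -
  have has: "has_seq_henstock_integral g (min p q) (max p q) (F (max p q) - F (min p q))"
    using deriv by (rule has_seq_henstock_integral_derivative)
  moreover have "(THE A. has_seq_henstock_integral g (min p q) (max p q) A) =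
      F (max p q) - F (min p q)"
    using has has_seq_henstock_integral_unique[of "min p q" "max p q"] by (intro the_equality) auto
  ultimately show ?thesis
    by (cases p q rule: linorder_cases)
      (auto simp: seq_henstock_integrable_def seq_henstock_integral_def)
qed

theorem theorem12:
  fixes f f' \<psi> \<psi>' :: "real \<Rightarrow> real" and a b c d :: real
  assumes "a < b" and "c < d"
    and "\<And>x. x \<in> {a..b} \<Longrightarrow> (\<psi> has_real_derivative \<psi>' x) (at x within {a..b})"
    and "\<psi> ` {a..b} \<subseteq> {c..d}"
    and "\<And>y. y \<in> {c..d} \<Longrightarrow> (f has_real_derivative f' y) (at y within {c..d})"
  shows "seq_henstock_integrable f' (\<psi> a) (\<psi> b) \<and>
         seq_henstock_integrable (\<lambda>x. (f' \<circ> \<psi>) x * \<psi>' x) a b \<and>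
         seq_henstock_integral f' (\<psi> a) (\<psi> b) =
           seq_henstock_integral (\<lambda>x. (f' \<circ> \<psi>) x * \<psi>' x) a b"
proof -
  have "\<psi> a \<in> {c..d}" "\<psi> b \<in> {c..d}"
    using assms(1,4) by (simp_all add: image_subset_iff)
  then have sub: "{min (\<psi> a) (\<psi> b)..max (\<psi> a) (\<psi> b)} \<subseteq> {c..d}"
    by auto
  have outer: "seq_henstock_integrable f' (\<psi> a) (\<psi> b) \<and>
      seq_henstock_integral f' (\<psi> a) (\<psi> b) = f (\<psi> b) - f (\<psi> a)"
    by (rule seq_henstock_integral_derivative) (use assms(5) sub DERIV_subset in blast)
  have "((f \<circ> \<psi>) has_real_derivative (f' \<circ> \<psi>) x * \<psi>' x) (at x within {a..b})"
    if "x \<in> {a..b}" for x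
  proof -
    have "(f has_real_derivative f' (\<psi> x)) (at (\<psi> x) within \<psi> ` {a..b})"
      using assms(4,5) that DERIV_subset by blast
    from DERIV_image_chain[OF this assms(3)[OF that]] show ?thesis by simp
  qed
  then have "seq_henstock_integrable (\<lambda>x. (f' \<circ> \<psi>) x * \<psi>' x) a b \<and>
      seq_henstock_integral (\<lambda>x. (f' \<circ> \<psi>) x * \<psi>' x) a b = (f \<circ> \<psi>) b - (f \<circ> \<psi>) a"
    using assms(1) by (intro seq_henstock_integral_derivative) (simp add: o_def)
  with outer show ?thesis by simp
qed

end
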